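(* Let $G$ be a (simple, undirected) graph on $n$ vertices with connectivity $k(G)$ satisfying $k(G)\geq\frac{n-1}{2}$. Then for any two adjacent vertices $x$ and $y$ with $d_x\geq d_y$, $$\kappa_{LLY}(x,y)\geq\frac{2k(G)-n+2}{d_x}.$$
   Context: The connectivity $k(G)$ of a non-complete graph is the minimum number of vertices whose removal disconnects $G$; for the complete graph $K_n$ it is $n-1$. $d(x,y)$ is the graph distance and $d_x$ the degree of $x$. For $p\in[0,1]$ and a vertex $x$, $\mu_x^p$ is the probability measure with $\mu_x^p(x)=p$, $\mu_x^p(y)=\frac{1-p}{d_x}$ if $y$ is adjacent to $x$, and $0$ otherwise. For probability measures $\mu_1,\mu_2$ on $V$, $W(\mu_1,\mu_2)=\inf_\pi\sum_{x,y}d(x,y)\pi(x,y)$ over all $\pi:V\times V\to[0,1]$ with marginals $\mu_1$ and $\mu_2$. For distinct vertices $x,y$, $\kappa_p(x,y)=1-\frac{W(\mu_x^p,\mu_y^p)}{d(x,y)}$ and $\kappa_{LLY}(x,y)=\lim_{p\to1}\frac{\kappa_p(x,y)}{1-p}$. *)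

theory Defs
  imports Complex_Main "Graph_Theory.Graph_Theory"
begin

text \<open>
  A finite simple undirected graph is a symmetric loop-free digraph without parallel arcs (locale
  \<^locale>\<open>graph\<close>); adjacency is \<^const>\<open>dominates\<close> and the degree of a vertex is \<^const>\<open>out_degree\<close>.
\<close>

text \<open>
  The library counts the graph without vertices as not connected. Restricting to proper subsets
  \<open>S\<close> keeps it out of consideration. For a non-complete graph the set is nonempty, since all
  vertices but two non-adjacent ones may be removed.
\<close>

definition vertex_connectivity :: "('a, 'b) pre_digraph \<Rightarrow> nat" where
  "vertex_connectivity G =
    (if complete_digraph (card (verts G)) G then card (verts G) - 1
     else Min (card ` {S. S \<subset> verts G \<and> \<not> Digraph_Component.connected (G \<restriction> (verts G - S))}))"

text \<open>
  The least number of arcs of a walk. The conversion from \<^typ>\<open>ereal\<close> sends \<open>\<infinity>\<close> to \<open>0\<close>, so this is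
  only meaningful for vertices of the same component.
\<close>

definition graph_dist :: "('a, 'b) pre_digraph \<Rightarrow> 'a \<Rightarrow> 'a \<Rightarrow> real" where
  "graph_dist G x y = real_of_ereal (wf_digraph.\<mu> G (\<lambda>_. 1) x y)"

definition lazy_walk :: "('a, 'b) pre_digraph \<Rightarrow> real \<Rightarrow> 'a \<Rightarrow> 'a \<Rightarrow> real" where
  "lazy_walk G p x y =
    (if y = x then p
     else if x \<rightarrow>\<^bsub>G\<^esub> y then (1 - p) / real (out_degree G x)
     else 0)"

definition couplings :: "'a set \<Rightarrow> ('a \<Rightarrow> real) \<Rightarrow> ('a \<Rightarrow> real) \<Rightarrow> ('a \<Rightarrow> 'a \<Rightarrow> real) set" where
  "couplings V m1 m2 =
    {\<pi>. (\<forall>u\<in>V. \<forall>v\<in>V. \<pi> u v \<in> {0..1}) \<and>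
        (\<forall>u\<in>V. (\<Sum>v\<in>V. \<pi> u v) = m1 u) \<and>
        (\<forall>v\<in>V. (\<Sum>u\<in>V. \<pi> u v) = m2 v)}"

definition wasserstein :: "('a, 'b) pre_digraph \<Rightarrow> ('a \<Rightarrow> real) \<Rightarrow> ('a \<Rightarrow> real) \<Rightarrow> real" where
  "wasserstein G m1 m2 =
    (INF \<pi> \<in> couplings (verts G) m1 m2. \<Sum>u\<in>verts G. \<Sum>v\<in>verts G. graph_dist G u v * \<pi> u v)"

definition ollivier_curvature :: "('a, 'b) pre_digraph \<Rightarrow> real \<Rightarrow> 'a \<Rightarrow> 'a \<Rightarrow> real" where
  "ollivier_curvature G p x y =
    1 - wasserstein G (lazy_walk G p x) (lazy_walk G p y) / graph_dist G x y"

text \<open>The limit is one-sided because \<open>lazy_walk G p\<close> is a probability measure only for \<open>p \<in> {0..1}\<close>.\<close>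

definition lly_curvature :: "('a, 'b) pre_digraph \<Rightarrow> 'a \<Rightarrow> 'a \<Rightarrow> real" where
  "lly_curvature G x y = Lim (at_left 1) (\<lambda>p. ollivier_curvature G p x y / (1 - p))"

end

theory Submission
  imports Defs
begin

text \<open>
  For adjacent \<open>x\<close>, \<open>y\<close> a coupling at idleness \<open>p\<close> mixed with the point mass at \<open>(x, y)\<close> is a
  coupling at any larger idleness, so \<open>\<kappa>\<^sub>p / (1 - p)\<close> increases with \<open>p\<close> and a single \<open>p\<close> suffices. For
  \<open>p = 1 / (d\<^sub>x + 1)\<close> the first measure is uniform on the closed neighbourhood of \<open>x\<close> and the second
  is at least as large as \<open>p\<close> on that of \<open>y\<close>. Leave the mass at \<open>x\<close>, \<open>y\<close> and their common neighbours
  in place, move as much as possible along a matching from the private neighbours of \<open>x\<close> to those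
  of \<open>y\<close>, and move the rest arbitrarily, at distance at most \<open>2\<close> because the minimum degree is at
  least \<open>(n - 1) / 2\<close>. The size of the matching is controlled by Koenig's theorem, since a small
  vertex cover would yield a small separating set.
\<close>

subsection \<open>Bipartite matchings\<close>

text \<open>Koenig's theorem: the image of \<open>X\<close> together with \<open>A - X\<close>
  covers every edge that starts in \<open>A\<close>, so the hypothesis bounds the size of such
  covers from below. Edges are deleted as long as it survives; in a minimal edge set right ends are
  not shared, so any choice of edges is a matching.\<close>

lemma bipartite_matching:
  fixes E :: "('a \<times> 'b) set"
  assumes "finite E" and "finite A"
    and "\<And>X. X \<subseteq> A \<Longrightarrow> m \<le> card (E `` X) + card (A - X)"
  shows "\<exists>T f. T \<subseteq> A \<and> inj_on f T \<and> (\<forall>a\<in>T. (a, f a) \<in> E) \<and> m \<le> card T"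
  using assms(1,3)
proof (induction E rule: finite_psubset_induct)
  case (psubset E)
  have finE: "finite (E `` X)" for X
    using psubset.hyps by (simp add: finite_Image)
  show ?case
  proof (cases "\<exists>e\<in>E. \<forall>X\<subseteq>A. m \<le> card ((E - {e}) `` X) + card (A - X)")
    case True
    then obtain e where e: "e \<in> E" "\<And>X. X \<subseteq> A \<Longrightarrow> m \<le> card ((E - {e}) `` X) + card (A - X)"
      by blast
    then have "E - {e} \<subset> E" by blast
    from psubset.IH[OF this e(2)] show ?thesis by blast
  next
    case False
    \<comment> \<open>Every edge is critical; uncrossing two tight sets shows that no two edges share a right end.\<close>
    have crit: "\<exists>X\<subseteq>A. a \<in> X \<and> b \<notin> E `` (X - {a}) \<and> b \<in> E `` X
        \<and> card (E `` X) + card (A - X) \<le> m"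
      if "(a, b) \<in> E" for a b
    proof -
      from False that obtain X where X: "X \<subseteq> A"
        "card ((E - {(a, b)}) `` X) + card (A - X) < m"
        by (metis not_le)
      have "card (E `` X) + card (A - X) \<ge> m" using psubset.prems X(1) by blast
      with X have ne: "(E - {(a, b)}) `` X \<noteq> E `` X" by auto
      then have a: "a \<in> X" and b: "b \<notin> (E - {(a, b)}) `` X" by auto
      \<comment> \<open>The edge contributes at most \<open>b\<close> to the image, so failure of
        the bound without it makes \<open>X\<close> tight for \<open>E\<close>.\<close>
      have "E `` X = insert b ((E - {(a, b)}) `` X)"
        using a that by auto
      then have "card (E `` X) \<le> Suc (card ((E - {(a, b)}) `` X))"
        by (simp add: card_insert_le_m1 card_insert_if finite_Image psubset.hyps)
      with X a b that show ?thesis by (intro exI[of _ X]) auto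
    qed
    have uniq: "a1 = a2" if e: "(a1, b) \<in> E" "(a2, b) \<in> E" for a1 a2 b
    proof (rule ccontr)
      assume neq: "a1 \<noteq> a2"
      obtain X where X: "X \<subseteq> A" "a1 \<in> X" "b \<notin> E `` (X - {a1})" "b \<in> E `` X"
        "card (E `` X) + card (A - X) \<le> m" using crit[OF e(1)] by blast
      obtain Y where Y: "Y \<subseteq> A" "a2 \<in> Y" "b \<notin> E `` (Y - {a2})" "b \<in> E `` Y"
        "card (E `` Y) + card (A - Y) \<le> m" using crit[OF e(2)] by blast
      have "a2 \<notin> X" using X(3) e(2) neq by auto
      \<comment> \<open>Within \<open>X\<close> only \<open>a1\<close> is adjacent to
        \<open>b\<close>, within \<open>Y\<close> only \<open>a2\<close>. So \<open>b\<close> makes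
        submodularity of the image size strict, and the union or the intersection of the tight sets
        violates the bound.\<close>
      have "b \<notin> E `` (X \<inter> Y)"
        using X(3) \<open>a2 \<notin> X\<close> Y(3) by auto
      then have "E `` (X \<inter> Y) \<subset> E `` X \<inter> E `` Y" using X(4) Y(4) by blast
      then have "card (E `` (X \<inter> Y)) < card (E `` X \<inter> E `` Y)"
        by (intro psubset_card_mono) (auto intro: finE)
      moreover have "card (E `` X) + card (E `` Y) = card (E `` (X \<union> Y)) + card (E `` X \<inter> E `` Y)"
        using card_Un_Int[OF finE finE, of X Y] by (simp add: Image_Un)
      moreover have "card (A - X) + card (A - Y) = card (A - X \<inter> Y) + card (A - (X \<union> Y))"
        using card_Un_Int[of "A - X" "A - Y"] assms(2)
        by (simp add: Diff_Int Diff_Un)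
      moreover have "m \<le> card (E `` (X \<union> Y)) + card (A - (X \<union> Y))"
        using psubset.prems[of "X \<union> Y"] X(1) Y(1) by blast
      moreover have "m \<le> card (E `` (X \<inter> Y)) + card (A - X \<inter> Y)"
        using psubset.prems[of "X \<inter> Y"] X(1) by blast
      ultimately show False using X(5) Y(5) by linarith
    qed
    define T where "T = {a \<in> A. \<exists>b. (a, b) \<in> E}"
    \<comment> \<open>The bound is applied to the left vertices without edges, whose image is
      empty.\<close>
    have "E `` (A - T) = {}" "A - (A - T) = T" unfolding T_def by auto
    then have "m \<le> card T" using psubset.prems[of "A - T"] by simp
    moreover have "\<forall>a\<in>T. (a, SOME b. (a, b) \<in> E) \<in> E"
      unfolding T_def by (auto intro: someI_ex)
    moreover have "inj_on (\<lambda>a. SOME b. (a, b) \<in> E) T"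
      using calculation(2) by (intro inj_onI) (metis uniq)
    ultimately show ?thesis
      unfolding T_def by (intro exI[of _ T] exI[of _ "\<lambda>a. SOME b. (a, b) \<in> E"]) (auto simp: T_def)
  qed
qed

subsection \<open>Connectivity and distances\<close>

context graph
begin

abbreviation nbrs :: "'a \<Rightarrow> 'a set" where
  "nbrs v \<equiv> arcs_ends G `` {v}"

lemma nbrs_subset: "nbrs v \<subseteq> verts G - {v}"
  using adj_in_verts(2) adj_not_same by blast

lemma finite_nbrs: "finite (nbrs v)"
  using nbrs_subset finite_verts by (meson finite_Diff finite_subset)

lemma out_degree_eq_card_nbrs: "out_degree G v = card (nbrs v)"
proof -
  have "nbrs v = head G ` out_arcs G v"
    by (auto simp: arcs_ends_conv)
  moreover have "inj_on (head G) (out_arcs G v)"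
    by (rule inj_onI) (auto intro: no_multi_arcs simp: arc_to_ends_def)
  ultimately show ?thesis
    by (simp add: out_degree_def card_image)
qed

text \<open>A walk in the induced subgraph that starts in \<open>X\<close> can never leave it; the
  symmetric closure adds nothing because arcs are already symmetric.\<close>

lemma nonadjacent_not_connected:
  assumes "X \<noteq> {}" "Y \<noteq> {}" "X \<inter> Y = {}" "X \<subseteq> verts G" "Y \<subseteq> verts G"
    and no_arc: "\<And>a b. a \<in> X \<Longrightarrow> b \<in> Y \<Longrightarrow> \<not> a \<rightarrow> b"
  shows "\<not> Digraph_Component.connected (G \<restriction> (X \<union> Y))"
proof
  assume "Digraph_Component.connected (G \<restriction> (X \<union> Y))"
  moreover obtain u v where uv: "u \<in> X" "v \<in> Y" using assms by blast
  ultimately have "(u, v) \<in> rtrancl_on (X \<union> Y) ((arcs_ends (G \<restriction> (X \<union> Y)))\<^sup>s)"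
    by (auto simp: connected_conv)
  then have "v \<in> X"
  proof (induction rule: rtrancl_on_induct)
    case (step a b)
    then have "a \<rightarrow> b"
      by (auto simp: symcl_def dest: dominates_induce_subgraphD graph_symmetric)
    with step no_arc show ?case by blast
  qed (use uv in auto)
  with uv assms(3) show False by blast
qed

text \<open>Removing all vertices outside \<open>X\<close> and \<open>Y\<close> disconnects the
  graph, and a non-adjacent pair rules out the complete case of
  \<open>vertex_connectivity\<close>.\<close>

lemma separation_bound:
  assumes "X \<noteq> {}" "Y \<noteq> {}" "X \<inter> Y = {}" "X \<subseteq> verts G" "Y \<subseteq> verts G"
    and no_arc: "\<And>a b. a \<in> X \<Longrightarrow> b \<in> Y \<Longrightarrow> \<not> a \<rightarrow> b"
  shows "vertex_connectivity G + card X + card Y \<le> card (verts G)"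
proof -
  obtain u v where uv: "u \<in> X" "v \<in> Y" using assms by blast
  then have "\<not> u \<rightarrow> v" "u \<noteq> v" "u \<in> verts G" "v \<in> verts G" using assms by blast+
  then have nc: "\<not> complete_digraph (card (verts G)) G"
    by (auto simp: complete_digraph_def)
  let ?S = "verts G - (X \<union> Y)"
  have "verts G - ?S = X \<union> Y" using assms by blast
  then have "\<not> Digraph_Component.connected (G \<restriction> (verts G - ?S))"
    using nonadjacent_not_connected[OF assms] by simp
  moreover have "?S \<subset> verts G" using uv assms by blast
  moreover have "finite {S. S \<subset> verts G \<and> \<not> Digraph_Component.connected (G \<restriction> (verts G - S))}"
    by (rule finite_subset[of _ "Pow (verts G)"]) auto
  ultimately have "vertex_connectivity G \<le> card ?S"
    unfolding vertex_connectivity_def using nc by (auto intro!: Min_le)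
  moreover have "card ?S = card (verts G) - card (X \<union> Y)"
    using assms finite_verts by (intro card_Diff_subset) (auto intro: finite_subset)
  moreover have "card (X \<union> Y) = card X + card Y"
    using assms finite_verts by (intro card_Un_disjoint) (auto intro: finite_subset)
  moreover have "card (X \<union> Y) \<le> card (verts G)"
    using assms by (intro card_mono) auto
  ultimately show ?thesis by linarith
qed

lemma vertex_connectivity_less:
  assumes "verts G \<noteq> {}"
  shows "vertex_connectivity G < card (verts G)"
proof (cases "complete_digraph (card (verts G)) G")
  case True
  then show ?thesis using assms by (simp add: vertex_connectivity_def card_gt_0_iff)
next
  case False
  have "graph G" by unfold_locales
  with False obtain u v where "u \<in> verts G" "v \<in> verts G" "u \<noteq> v" "\<not> u \<rightarrow> v"
    using adj_in_verts adj_not_same unfolding complete_digraph_def by auto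
  then show ?thesis using separation_bound[of "{u}" "{v}"] by auto
qed

text \<open>The neighbours of \<open>v\<close> separate it from the remaining vertices. If none
  remain, the degree is one less than the order and the strict bound applies.\<close>

lemma vertex_connectivity_le_out_degree:
  assumes "v \<in> verts G"
  shows "vertex_connectivity G \<le> out_degree G v"
proof -
  let ?Y = "verts G - insert v (nbrs v)"
  have sub: "insert v (nbrs v) \<subseteq> verts G" using assms nbrs_subset by blast
  have "card (insert v (nbrs v)) = Suc (out_degree G v)"
    using nbrs_subset[of v] finite_nbrs[of v] by (subst card_insert_disjoint) (auto simp: out_degree_eq_card_nbrs)
  moreover have "card ?Y = card (verts G) - card (insert v (nbrs v))"
    using sub finite_nbrs by (intro card_Diff_subset) auto
  moreover have "card (insert v (nbrs v)) \<le> card (verts G)"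
    using sub by (intro card_mono) auto
  ultimately have c: "card ?Y + Suc (out_degree G v) = card (verts G)" by linarith
  show ?thesis
  proof (cases "?Y = {}")
    case True
    then have "card ?Y = 0" by simp
    moreover have "verts G \<noteq> {}" using assms by blast
    ultimately show ?thesis using c vertex_connectivity_less by linarith
  next
    case False
    have "vertex_connectivity G + card {v} + card ?Y \<le> card (verts G)"
      by (rule separation_bound) (use False assms in blast)+
    then show ?thesis using c by simp
  qed
qed

text \<open>The right-hand side is the sum of the two degrees.\<close>

lemma card_nbrs_Int:
  assumes "u \<in> verts G" "v \<in> verts G"
  shows "2 * vertex_connectivity G \<le> card (nbrs u \<inter> nbrs v) + card (nbrs u \<union> nbrs v)"
  using card_Un_Int[OF finite_nbrs finite_nbrs, of u v]
    vertex_connectivity_le_out_degree[OF assms(1)] vertex_connectivity_le_out_degree[OF assms(2)]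
  by (simp add: out_degree_eq_card_nbrs)

text \<open>Neither neighbourhood contains \<open>u\<close> or \<open>v\<close>, so with n vertices
  the union has at most n - 2 elements, while the degrees add up to at least n - 1.\<close>

lemma common_nbr:
  assumes k: "card (verts G) \<le> 2 * vertex_connectivity G + 1"
    and uv: "u \<in> verts G" "v \<in> verts G" "u \<noteq> v" "\<not> u \<rightarrow> v"
  shows "\<exists>w. u \<rightarrow> w \<and> w \<rightarrow> v"
proof -
  have "nbrs u \<union> nbrs v \<subseteq> verts G - {u, v}"
    using nbrs_subset[of u] nbrs_subset[of v] uv graph_symmetric by blast
  then have "card (nbrs u \<union> nbrs v) \<le> card (verts G - {u, v})"
    by (intro card_mono) auto
  also have "\<dots> + 2 = card (verts G)"
    using uv card_mono[of "verts G" "{u, v}"] by (subst card_Diff_subset) auto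
  finally have "nbrs u \<inter> nbrs v \<noteq> {}"
    using card_nbrs_Int[OF uv(1,2)] k by (auto simp del: Int_iff)
  then show ?thesis using graph_symmetric by blast
qed

section \<open>Distances from walks\<close>

lemma graph_dist_le_length:
  assumes "awalk u p v"
  shows "graph_dist G u v \<le> real (length p)"
proof -
  have "\<mu> (\<lambda>_. 1) u v \<le> ereal (awalk_cost (\<lambda>_. 1) p)"
    using assms unfolding \<mu>_def by (intro INF_lower) auto
  moreover have "0 \<le> \<mu> (\<lambda>_. 1) u v"
    unfolding \<mu>_def by (intro INF_greatest) (auto simp: awalk_cost_def sum_list_triv)
  ultimately show ?thesis
    unfolding graph_dist_def
    by (cases "\<mu> (\<lambda>_. 1) u v") (auto simp: awalk_cost_def sum_list_triv)
qed

lemma graph_dist_self: "v \<in> verts G \<Longrightarrow> graph_dist G v v \<le> 0"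
  using graph_dist_le_length[of v "[]" v] by (simp add: awalk_Nil_iff)

lemma graph_dist_nonneg: "0 \<le> graph_dist G u v"
proof -
  have "0 \<le> \<mu> (\<lambda>_. 1) u v"
    unfolding \<mu>_def by (intro INF_greatest) (auto simp: awalk_cost_def sum_list_triv)
  then show ?thesis unfolding graph_dist_def by (rule real_of_ereal_pos)
qed

lemma graph_dist_ge_1:
  assumes "u \<rightarrow>\<^sup>* v" "u \<noteq> v"
  shows "1 \<le> graph_dist G u v"
proof -
  have "1 \<le> \<mu> (\<lambda>_. 1) u v"
    unfolding \<mu>_def
  proof (rule INF_greatest)
    fix p assume "p \<in> {p. awalk u p v}"
    with assms(2) have "p \<noteq> []" by (auto simp: awalk_Nil_iff)
    then show "1 \<le> ereal (awalk_cost (\<lambda>_. 1) p)"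
      by (cases p) (auto simp: awalk_cost_def sum_list_triv)
  qed
  \<comment> \<open>An infinite value would be converted to 0 and break the bound.\<close>
  moreover have "\<mu> (\<lambda>_. 1) u v < \<infinity>" using assms(1) \<mu>_reach_conv by blast
  ultimately show ?thesis
    unfolding graph_dist_def by (cases "\<mu> (\<lambda>_. 1) u v") auto
qed

lemma graph_dist_adjacent:
  assumes "u \<rightarrow> v"
  shows "graph_dist G u v = 1"
proof (rule antisym)
  obtain e where "e \<in> arcs G" "tail G e = u" "head G e = v" using assms by auto
  then have "awalk u [e] v" using arc_implies_awalk by blast
  from graph_dist_le_length[OF this] show "graph_dist G u v \<le> 1" by simp
  show "1 \<le> graph_dist G u v"
    using assms adj_not_same by (intro graph_dist_ge_1) auto
qed

lemma graph_dist_common_nbr: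
  assumes "u \<rightarrow> w" "w \<rightarrow> v"
  shows "graph_dist G u v \<le> 2"
proof -
  obtain e where e: "e \<in> arcs G" "tail G e = u" "head G e = w" using assms by auto
  obtain e' where e': "e' \<in> arcs G" "tail G e' = w" "head G e' = v" using assms by auto
  have "awalk u [e, e'] v" using e e' by (auto simp: awalk_simps)
  from graph_dist_le_length[OF this] show ?thesis by simp
qed

lemma dense_graph_dist_le_2:
  assumes "card (verts G) \<le> 2 * vertex_connectivity G + 1"
    and "u \<in> verts G" "v \<in> verts G"
  shows "graph_dist G u v \<le> 2"
proof -
  consider "u = v" | "u \<rightarrow> v" | "u \<noteq> v" "\<not> u \<rightarrow> v" by blast
  then show ?thesis
  proof cases
    case 1
    then show ?thesis using graph_dist_self assms by fastforce
  next
    case 2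
    then show ?thesis by (simp add: graph_dist_adjacent)
  next
    case 3
    then show ?thesis using common_nbr assms graph_dist_common_nbr by blast
  qed
qed

text \<open>Makes \<open>graph_dist_ge_1\<close> available for all pairs of distinct
  vertices.\<close>

lemma dense_reachable:
  assumes "card (verts G) \<le> 2 * vertex_connectivity G + 1"
    and "u \<in> verts G" "v \<in> verts G"
  shows "u \<rightarrow>\<^sup>* v"
  using assms common_nbr[OF assms] by (metis adj_reachable_trans reachable_adjI reachable_refl)

end

subsection \<open>Couplings\<close>

text \<open>The upper bound 1 on the entries is automatic: each is at most the total mass.\<close>

lemma couplingsI:
  assumes "finite V" and "\<And>u v. u \<in> V \<Longrightarrow> v \<in> V \<Longrightarrow> 0 \<le> \<pi> u v"
    and "\<And>u. u \<in> V \<Longrightarrow> (\<Sum>v\<in>V. \<pi> u v) = m1 u"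
    and "\<And>v. v \<in> V \<Longrightarrow> (\<Sum>u\<in>V. \<pi> u v) = m2 v"
    and "(\<Sum>u\<in>V. m1 u) = 1"
  shows "\<pi> \<in> couplings V m1 m2"
proof -
  have "\<pi> u v \<le> 1" if uv: "u \<in> V" "v \<in> V" for u v
  proof -
    have "\<pi> u v \<le> (\<Sum>v\<in>V. \<pi> u v)" using assms(1,2) uv by (intro member_le_sum) auto
    also have "\<dots> \<le> (\<Sum>u\<in>V. \<Sum>v\<in>V. \<pi> u v)"
      using assms(1,2) uv by (intro member_le_sum[of u V "\<lambda>u. \<Sum>v\<in>V. \<pi> u v"] sum_nonneg) auto
    also have "\<dots> = 1" using assms(3,5) by simp
    finally show ?thesis .
  qed
  then show ?thesis using assms unfolding couplings_def by auto
qed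

lemma couplings_nonneg: "\<pi> \<in> couplings V m1 m2 \<Longrightarrow> u \<in> V \<Longrightarrow> v \<in> V \<Longrightarrow> 0 \<le> \<pi> u v"
  and couplings_row: "\<pi> \<in> couplings V m1 m2 \<Longrightarrow> u \<in> V \<Longrightarrow> (\<Sum>v\<in>V. \<pi> u v) = m1 u"
  and couplings_col: "\<pi> \<in> couplings V m1 m2 \<Longrightarrow> v \<in> V \<Longrightarrow> (\<Sum>u\<in>V. \<pi> u v) = m2 v"
  unfolding couplings_def by auto

text \<open>The mass left over by a partial coupling is distributed by the product measure.\<close>

lemma coupling_extends_partial:
  fixes \<sigma> :: "'a \<Rightarrow> 'a \<Rightarrow> real"
  assumes fin: "finite V"
    and nonneg: "\<And>u v. u \<in> V \<Longrightarrow> v \<in> V \<Longrightarrow> 0 \<le> \<sigma> u v"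
    and row: "\<And>u. u \<in> V \<Longrightarrow> (\<Sum>v\<in>V. \<sigma> u v) \<le> m1 u"
    and col: "\<And>v. v \<in> V \<Longrightarrow> (\<Sum>u\<in>V. \<sigma> u v) \<le> m2 v"
    and total: "(\<Sum>u\<in>V. m1 u) = 1" "(\<Sum>v\<in>V. m2 v) = 1"
  shows "\<exists>\<pi>\<in>couplings V m1 m2. \<forall>u\<in>V. \<forall>v\<in>V. \<sigma> u v \<le> \<pi> u v"
proof -
  define r where "r u = m1 u - (\<Sum>v\<in>V. \<sigma> u v)" for u
  define s where "s v = m2 v - (\<Sum>u\<in>V. \<sigma> u v)" for v
  define \<rho> where "\<rho> = 1 - (\<Sum>u\<in>V. \<Sum>v\<in>V. \<sigma> u v)"
  \<comment> \<open>The product of the leftovers \<open>r\<close> and \<open>s\<close> has total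
    mass \<rho> squared, hence the division.\<close>
  define \<pi> where "\<pi> u v = \<sigma> u v + r u * s v / \<rho>" for u v
  have r: "0 \<le> r u" if "u \<in> V" for u using row that by (simp add: r_def)
  have s: "0 \<le> s v" if "v \<in> V" for v using col that by (simp add: s_def)
  have sum_r: "(\<Sum>u\<in>V. r u) = \<rho>" by (simp add: r_def \<rho>_def sum_subtractf total)
  have sum_s: "(\<Sum>v\<in>V. s v) = \<rho>"
    using sum.swap[of \<sigma> V V] by (simp add: s_def \<rho>_def sum_subtractf total)
  have \<rho>: "0 \<le> \<rho>" using sum_nonneg[of V r] r sum_r by auto
  \<comment> \<open>For \<rho> = 0 the quotient in \<open>\<pi>\<close> is 0 by convention, which is
    right because both leftovers vanish.\<close>
  have r0: "r u = 0" if "\<rho> = 0" "u \<in> V" for u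
    using that sum_r r fin by (metis sum_nonneg_eq_0_iff)
  have s0: "s v = 0" if "\<rho> = 0" "v \<in> V" for v
    using that sum_s s fin by (metis sum_nonneg_eq_0_iff)
  have le: "\<sigma> u v \<le> \<pi> u v" if "u \<in> V" "v \<in> V" for u v
    using r s \<rho> that by (simp add: \<pi>_def)
  have "(\<Sum>v\<in>V. \<pi> u v) = m1 u" if "u \<in> V" for u
  proof -
    have "(\<Sum>v\<in>V. r u * s v / \<rho>) = r u * \<rho> / \<rho>"
      by (simp add: sum_s flip: sum_divide_distrib sum_distrib_left)
    then show ?thesis using r0 that by (cases "\<rho> = 0") (auto simp: \<pi>_def sum.distrib r_def)
  qed
  moreover have "(\<Sum>u\<in>V. \<pi> u v) = m2 v" if "v \<in> V" for v
  proof -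
    have "(\<Sum>u\<in>V. r u * s v / \<rho>) = \<rho> * s v / \<rho>"
      by (simp add: sum_r flip: sum_divide_distrib sum_distrib_right)
    then show ?thesis using s0 that by (cases "\<rho> = 0") (auto simp: \<pi>_def sum.distrib s_def)
  qed
  ultimately have "\<pi> \<in> couplings V m1 m2"
    using fin total order_trans[OF nonneg le] by (intro couplingsI) auto
  with le show ?thesis by blast
qed

section \<open>Bounds on the Wasserstein distance\<close>

context graph
begin

lemma transport_cost_nonneg:
  assumes "\<pi> \<in> couplings (verts G) m1 m2"
  shows "0 \<le> (\<Sum>u\<in>verts G. \<Sum>v\<in>verts G. graph_dist G u v * \<pi> u v)"
  using assms by (intro sum_nonneg mult_nonneg_nonneg graph_dist_nonneg) (auto dest: couplings_nonneg)

lemma wasserstein_le: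
  assumes "\<pi> \<in> couplings (verts G) m1 m2"
  shows "wasserstein G m1 m2 \<le> (\<Sum>u\<in>verts G. \<Sum>v\<in>verts G. graph_dist G u v * \<pi> u v)"
  unfolding wasserstein_def
  by (intro cINF_lower[OF _ assms] bdd_belowI2[of _ 0] transport_cost_nonneg)

lemma wasserstein_greatest:
  assumes "(\<Sum>u\<in>verts G. m1 u) = 1" "(\<Sum>v\<in>verts G. m2 v) = 1"
    and "\<And>u. u \<in> verts G \<Longrightarrow> 0 \<le> m1 u" "\<And>v. v \<in> verts G \<Longrightarrow> 0 \<le> m2 v"
    and "\<And>\<pi>. \<pi> \<in> couplings (verts G) m1 m2 \<Longrightarrow>
      c \<le> (\<Sum>u\<in>verts G. \<Sum>v\<in>verts G. graph_dist G u v * \<pi> u v)"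
  shows "c \<le> wasserstein G m1 m2"
proof -
  \<comment> \<open>The infimum is meaningful only over a nonempty set; extending the zero partial
    coupling yields an element.\<close>
  have "couplings (verts G) m1 m2 \<noteq> {}"
    using coupling_extends_partial[of "verts G" "\<lambda>_ _. 0" m1 m2] assms by auto
  then show ?thesis unfolding wasserstein_def using assms(5) by (rule cINF_greatest)
qed

text \<open>Mass \<open>p\<close> travels from each \<open>u\<close> in \<open>T\<close> to
  \<open>f u\<close>, and the remaining mass travels at most \<open>D\<close>. Injectivity of
  \<open>f\<close> keeps the load of every target at \<open>p\<close>.\<close>

lemma wasserstein_partial_matching:
  assumes total: "(\<Sum>u\<in>verts G. m1 u) = 1" "(\<Sum>v\<in>verts G. m2 v) = 1"
    and nonneg: "\<And>u. u \<in> verts G \<Longrightarrow> 0 \<le> m1 u" "\<And>v. v \<in> verts G \<Longrightarrow> 0 \<le> m2 v"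
    and dist: "\<And>u v. u \<in> verts G \<Longrightarrow> v \<in> verts G \<Longrightarrow> graph_dist G u v \<le> D"
    and T: "T \<subseteq> verts G" "f ` T \<subseteq> verts G" "inj_on f T"
    and p: "0 \<le> p" "\<And>u. u \<in> T \<Longrightarrow> p \<le> m1 u" "\<And>u. u \<in> T \<Longrightarrow> p \<le> m2 (f u)"
  shows "wasserstein G m1 m2 \<le> p * (\<Sum>u\<in>T. graph_dist G u (f u)) + D * (1 - p * real (card T))"
proof -
  define \<sigma> where "\<sigma> u v = (if u \<in> T \<and> v = f u then p else 0)" for u v
  have finT: "finite T" using T(1) finite_verts finite_subset by blast
  \<comment> \<open>The weight \<open>g\<close> serves twice: the distance gives the cost of
    \<sigma>, the constant 1 its mass.\<close>
  have inner: "(\<Sum>v\<in>verts G. g v * \<sigma> u v) = (if u \<in> T then g (f u) * p else 0)"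
    for g :: "'a \<Rightarrow> real" and u
    using T(2) by (auto simp: \<sigma>_def if_distrib[of "(*) _"] cong: if_cong)
  have row: "(\<Sum>v\<in>verts G. \<sigma> u v) \<le> m1 u" if "u \<in> verts G" for u
    using inner[of "\<lambda>_. 1" u] p nonneg that by auto
  have col: "(\<Sum>u\<in>verts G. \<sigma> u v) \<le> m2 v" if "v \<in> verts G" for v
  proof (cases "v \<in> f ` T")
    case True
    then obtain w where w: "w \<in> T" "v = f w" by blast
    then have "\<sigma> u v = (if u = w then p else 0)" for u
      using T(3) by (auto simp: \<sigma>_def inj_on_def)
    then show ?thesis using w T(1) p(3) by (simp add: subset_iff)
  next
    case False
    then have "\<sigma> u v = 0" for u by (auto simp: \<sigma>_def)
    then show ?thesis using nonneg that by simp
  qed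
  have "0 \<le> \<sigma> u v" for u v using p(1) by (simp add: \<sigma>_def)
  then obtain \<pi> where \<pi>: "\<pi> \<in> couplings (verts G) m1 m2"
    "\<And>u v. u \<in> verts G \<Longrightarrow> v \<in> verts G \<Longrightarrow> \<sigma> u v \<le> \<pi> u v"
    using coupling_extends_partial[OF finite_verts _ row col total] by blast
  have outer: "(\<Sum>u\<in>verts G. if u \<in> T then g u else 0) = (\<Sum>u\<in>T. g u)" for g :: "'a \<Rightarrow> real"
    using T(1) by (simp add: sum.If_cases Int_absorb1 flip: sum.inter_restrict)
  have cost: "(\<Sum>u\<in>verts G. \<Sum>v\<in>verts G. graph_dist G u v * \<sigma> u v) = p * (\<Sum>u\<in>T. graph_dist G u (f u))"
    by (simp only: inner outer sum_distrib_left mult.commute[of _ p])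
  have mass: "(\<Sum>u\<in>verts G. \<Sum>v\<in>verts G. \<sigma> u v) = p * real (card T)"
    using inner[of "\<lambda>_. 1"] by (simp add: outer mult.commute)
  have "wasserstein G m1 m2 \<le> (\<Sum>u\<in>verts G. \<Sum>v\<in>verts G. graph_dist G u v * \<pi> u v)"
    using \<pi>(1) by (rule wasserstein_le)
  also have "\<dots> \<le> (\<Sum>u\<in>verts G. \<Sum>v\<in>verts G. graph_dist G u v * \<sigma> u v + D * (\<pi> u v - \<sigma> u v))"
  proof (intro sum_mono)
    fix u v assume uv: "u \<in> verts G" "v \<in> verts G"
    then have "graph_dist G u v * (\<pi> u v - \<sigma> u v) \<le> D * (\<pi> u v - \<sigma> u v)"
      using dist \<pi>(2) by (intro mult_right_mono) auto
    then show "graph_dist G u v * \<pi> u v \<le> graph_dist G u v * \<sigma> u v + D * (\<pi> u v - \<sigma> u v)"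
      by (simp add: algebra_simps)
  qed
  also have "\<dots> = (\<Sum>u\<in>verts G. \<Sum>v\<in>verts G. graph_dist G u v * \<sigma> u v)
      + D * ((\<Sum>u\<in>verts G. \<Sum>v\<in>verts G. \<pi> u v) - (\<Sum>u\<in>verts G. \<Sum>v\<in>verts G. \<sigma> u v))"
    by (simp add: sum.distrib sum_subtractf flip: sum_distrib_left)
  also have "(\<Sum>u\<in>verts G. \<Sum>v\<in>verts G. \<pi> u v) = 1"
    using couplings_row[OF \<pi>(1)] total by simp
  finally show ?thesis by (simp add: cost mass)
qed

subsection \<open>Curvature\<close>

lemma lazy_walk_nonneg: "p \<in> {0..1} \<Longrightarrow> 0 \<le> lazy_walk G p v u"
  by (simp add: lazy_walk_def)

text \<open>The neighbour \<open>w\<close> makes the degree positive; an isolated vertex would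
  retain only mass \<open>p\<close>.\<close>

lemma sum_lazy_walk:
  assumes "v \<rightarrow> w"
  shows "(\<Sum>u\<in>verts G. lazy_walk G p v u) = 1"
proof -
  have v: "v \<in> verts G" using assms adj_in_verts by blast
  have pos: "0 < out_degree G v"
    using assms finite_nbrs by (auto simp: out_degree_eq_card_nbrs card_gt_0_iff)
  have "(\<Sum>u\<in>verts G. lazy_walk G p v u)
      = p + (\<Sum>u\<in>verts G - {v}. if u \<in> nbrs v then (1 - p) / real (out_degree G v) else 0)"
    using v by (subst sum.remove[of _ v]) (auto simp: lazy_walk_def intro!: sum.cong)
  also have "(\<Sum>u\<in>verts G - {v}. if u \<in> nbrs v then (1 - p) / real (out_degree G v) else 0)
      = (\<Sum>u\<in>nbrs v. (1 - p) / real (out_degree G v))"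
    using nbrs_subset[of v] by (intro sum.mono_neutral_cong_right) auto
  also have "\<dots> = 1 - p" using pos by (simp add: out_degree_eq_card_nbrs)
  finally show ?thesis by simp
qed

lemma wasserstein_lazy_walk_interpolate:
  assumes "x \<rightarrow> y" "0 \<le> p" "p \<le> q" "q < 1"
  shows "(1 - wasserstein G (lazy_walk G p x) (lazy_walk G p y)) / (1 - p)
    \<le> (1 - wasserstein G (lazy_walk G q x) (lazy_walk G q y)) / (1 - q)"
proof -
  let ?W = "\<lambda>p. wasserstein G (lazy_walk G p x) (lazy_walk G p y)"
  \<comment> \<open>With this weight, \<open>t\<close> times the walk at \<open>p\<close> plus
    \<open>1 - t\<close> times the point mass at its start is the walk at \<open>q\<close>.\<close>
  define t where "t = (1 - q) / (1 - p)"
  have t: "0 < t" "t \<le> 1" "t * (1 - p) = 1 - q" using assms by (auto simp: t_def)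
  have yx: "y \<rightarrow> x" using assms(1) by (rule graph_symmetric)
  have xy: "x \<in> verts G" "y \<in> verts G" using assms(1) adj_in_verts by blast+
  have "t * p + (1 - t) = q" using t(3) by (simp add: algebra_simps)
  then have scale: "t * lazy_walk G p v u + (1 - t) * (if u = v then 1 else 0) = lazy_walk G q v u" for v u
    using t(3) by (simp add: lazy_walk_def)
  \<comment> \<open>Solved for \<open>?W p\<close>, the claim becomes a lower bound on the cost of
    every coupling, so no optimal one is needed.\<close>
  have "(?W q - (1 - t)) / t \<le> ?W p"
  proof (rule wasserstein_greatest)
    fix \<pi> assume \<pi>: "\<pi> \<in> couplings (verts G) (lazy_walk G p x) (lazy_walk G p y)"
    define \<pi>' where "\<pi>' u v = t * \<pi> u v + (1 - t) * (if u = x \<and> v = y then 1 else 0)" for u v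
    have in_row: "(\<Sum>v\<in>verts G. if u = x \<and> v = y then g v else 0) = (if u = x then g y else 0)"
      for u and g :: "'a \<Rightarrow> real" using xy by simp
    have in_col: "(\<Sum>u\<in>verts G. if u = x \<and> v = y then g u else 0) = (if v = y then g x else 0)"
      for v and g :: "'a \<Rightarrow> real" using xy by (cases "v = y") simp_all
    have "\<pi>' \<in> couplings (verts G) (lazy_walk G q x) (lazy_walk G q y)"
    proof (rule couplingsI)
      show "0 \<le> \<pi>' u v" if "u \<in> verts G" "v \<in> verts G" for u v
        using t couplings_nonneg[OF \<pi> that] by (simp add: \<pi>'_def)
      show "(\<Sum>v\<in>verts G. \<pi>' u v) = lazy_walk G q x u" if "u \<in> verts G" for u
        using couplings_row[OF \<pi> that] scale[of x u]
        by (simp add: \<pi>'_def sum.distrib in_row flip: sum_distrib_left)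
      show "(\<Sum>u\<in>verts G. \<pi>' u v) = lazy_walk G q y v" if "v \<in> verts G" for v
        using couplings_col[OF \<pi> that] scale[of y v]
        by (simp add: \<pi>'_def sum.distrib in_col flip: sum_distrib_left)
    qed (use assms sum_lazy_walk in auto)
    then have "?W q \<le> (\<Sum>u\<in>verts G. \<Sum>v\<in>verts G. graph_dist G u v * \<pi>' u v)"
      by (rule wasserstein_le)
    also have "\<dots> = (\<Sum>u\<in>verts G. \<Sum>v\<in>verts G. t * (graph_dist G u v * \<pi> u v)
        + (if u = x \<and> v = y then (1 - t) * graph_dist G x v else 0))"
      by (intro sum.cong) (auto simp: \<pi>'_def algebra_simps)
    also have "\<dots> = t * (\<Sum>u\<in>verts G. \<Sum>v\<in>verts G. graph_dist G u v * \<pi> u v) + (1 - t)"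
      using assms(1) xy by (simp add: sum.distrib in_row graph_dist_adjacent flip: sum_distrib_left)
    finally show "(?W q - (1 - t)) / t \<le> (\<Sum>u\<in>verts G. \<Sum>v\<in>verts G. graph_dist G u v * \<pi> u v)"
      using t(1) by (simp add: field_simps)
  qed (use assms yx sum_lazy_walk lazy_walk_nonneg in auto)
  then have "t * (1 - ?W p) \<le> 1 - ?W q" using t(1) by (simp add: field_simps)
  then show ?thesis using assms by (simp add: t_def field_simps)
qed

text \<open>The second measure has at most \<open>1 - p\<close> at \<open>x\<close>, so of the mass
  \<open>p\<close> there at least \<open>2 * p - 1\<close> must move, at distance at least 1. This
  keeps the curvature quotient bounded.\<close>

lemma wasserstein_lazy_walk_ge:
  assumes "x \<rightarrow> y" "p \<in> {0..1}" and reach: "\<And>u v. u \<in> verts G \<Longrightarrow> v \<in> verts G \<Longrightarrow> u \<rightarrow>\<^sup>* v"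
  shows "2 * p - 1 \<le> wasserstein G (lazy_walk G p x) (lazy_walk G p y)"
proof (rule wasserstein_greatest)
  have yx: "y \<rightarrow> x" using assms(1) by (rule graph_symmetric)
  then show "(\<Sum>u\<in>verts G. lazy_walk G p y u) = 1" by (rule sum_lazy_walk)
  have x: "x \<in> verts G" "x \<noteq> y" using assms(1) adj_in_verts adj_not_same by blast+
  have "1 \<le> out_degree G y"
    using yx finite_nbrs by (auto simp: out_degree_eq_card_nbrs card_gt_0_iff Suc_le_eq)
  then have "(1 - p) / real (out_degree G y) \<le> (1 - p) / 1"
    using assms(2) by (intro divide_left_mono) auto
  then have small: "lazy_walk G p y x \<le> 1 - p"
    using x yx by (simp add: lazy_walk_def)
  fix \<pi> assume \<pi>: "\<pi> \<in> couplings (verts G) (lazy_walk G p x) (lazy_walk G p y)"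
  have "\<pi> x x \<le> (\<Sum>u\<in>verts G. \<pi> u x)"
    using x couplings_nonneg[OF \<pi>] by (intro member_le_sum[of x _ "\<lambda>u. \<pi> u x"]) auto
  then have "\<pi> x x \<le> 1 - p" using small couplings_col[OF \<pi> x(1)] by simp
  moreover have "(\<Sum>v\<in>verts G. \<pi> x v) = p"
    using couplings_row[OF \<pi> x(1)] by (simp add: lazy_walk_def)
  then have "\<pi> x x + (\<Sum>v\<in>verts G - {x}. \<pi> x v) = p"
    using x(1) sum.remove[of "verts G" x "\<pi> x"] by simp
  ultimately have "2 * p - 1 \<le> (\<Sum>v\<in>verts G - {x}. \<pi> x v)" by linarith
  also have "\<dots> \<le> (\<Sum>v\<in>verts G - {x}. graph_dist G x v * \<pi> x v)"
  proof (rule sum_mono)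
    fix v assume "v \<in> verts G - {x}"
    then show "\<pi> x v \<le> graph_dist G x v * \<pi> x v"
      using mult_right_mono[OF graph_dist_ge_1[OF reach] couplings_nonneg[OF \<pi>], of x v x v] x by auto
  qed
  also have "\<dots> \<le> (\<Sum>v\<in>verts G. graph_dist G x v * \<pi> x v)"
    using couplings_nonneg[OF \<pi> x(1)] x(1)
    by (intro sum_mono2) (auto intro: mult_nonneg_nonneg graph_dist_nonneg)
  also have "\<dots> \<le> (\<Sum>u\<in>verts G. \<Sum>v\<in>verts G. graph_dist G u v * \<pi> u v)"
    using x(1) couplings_nonneg[OF \<pi>]
    by (intro member_le_sum[of x _ "\<lambda>u. \<Sum>v\<in>verts G. graph_dist G u v * \<pi> u v"])
      (auto intro!: sum_nonneg mult_nonneg_nonneg graph_dist_nonneg)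
  finally show "2 * p - 1 \<le> (\<Sum>u\<in>verts G. \<Sum>v\<in>verts G. graph_dist G u v * \<pi> u v)" .
qed (use assms sum_lazy_walk lazy_walk_nonneg in auto)

end

text \<open>\<open>Lim\<close> says something only once convergence is known; a bounded monotone
  function converges to its supremum.\<close>

lemma mono_on_le_Lim_at_left:
  fixes h :: "real \<Rightarrow> real"
  assumes mono: "mono_on {a..<b} h" and bound: "\<And>q. q \<in> {a..<b} \<Longrightarrow> h q \<le> B"
    and p: "p \<in> {a..<b}"
  shows "h p \<le> Lim (at_left b) h"
proof -
  define L where "L = Sup (h ` {a..<b})"
  have bdd: "bdd_above (h ` {a..<b})" using bound by (rule bdd_aboveI2)
  have up: "h q \<le> L" if "q \<in> {a..<b}" for q
    unfolding L_def using bdd that by (intro cSup_upper) auto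
  have "(h \<longlongrightarrow> L) (at_left b)"
  proof (rule increasing_tendsto)
    show "\<forall>\<^sub>F q in at_left b. h q \<le> L"
      using eventually_at_left_real[of a b] p up by (auto elim!: eventually_mono)
  next
    fix l assume "l < L"
    then obtain q where q: "q \<in> {a..<b}" "l < h q"
      unfolding L_def using p bdd by (subst (asm) less_cSup_iff) auto
    show "\<forall>\<^sub>F r in at_left b. l < h r"
      using eventually_at_left_real[of q b]
    proof (rule eventually_mono)
      fix r assume "r \<in> {q<..<b}"
      then have "h q \<le> h r" using q by (intro mono_onD[OF mono]) auto
      then show "l < h r" using q by simp
    qed (use q in auto)
  qed
  then have "Lim (at_left b) h = L" by (intro tendsto_Lim) (auto simp: trivial_limit_at_left_real)
  then show ?thesis using up p by simp
qed

context graph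
begin

lemma ollivier_le_lly_curvature:
  assumes "x \<rightarrow> y" "0 \<le> p" "p < 1"
    and "\<And>u v. u \<in> verts G \<Longrightarrow> v \<in> verts G \<Longrightarrow> u \<rightarrow>\<^sup>* v"
  shows "ollivier_curvature G p x y / (1 - p) \<le> lly_curvature G x y"
  unfolding lly_curvature_def
proof (rule mono_on_le_Lim_at_left[where a = 0 and B = 2])
  have eq: "ollivier_curvature G p x y = 1 - wasserstein G (lazy_walk G p x) (lazy_walk G p y)" for p
    using assms(1) by (simp add: ollivier_curvature_def graph_dist_adjacent)
  show "mono_on {0..<1} (\<lambda>p. ollivier_curvature G p x y / (1 - p))"
    unfolding eq by (intro mono_onI wasserstein_lazy_walk_interpolate assms(1)) auto
  fix q :: real assume q: "q \<in> {0..<1}"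
  \<comment> \<open>Hence 1 minus the distance is at most \<open>2 * (1 - q)\<close>, which explains
    \<open>B = 2\<close>.\<close>
  then have "2 * q - 1 \<le> wasserstein G (lazy_walk G q x) (lazy_walk G q y)"
    using assms by (intro wasserstein_lazy_walk_ge) auto
  with q show "ollivier_curvature G q x y / (1 - q) \<le> 2"
    unfolding eq by (simp add: field_simps)
qed (use assms in auto)

text \<open>
  By Koenig's theorem the matching exists unless some \<open>X\<close> on the left has too few neighbours on the
  right. In that case \<open>X\<close> is separated from \<open>y\<close> and the non-neighbours of \<open>X\<close> on the right by fewer
  than \<open>vertex_connectivity G\<close> vertices.
\<close>

lemma private_nbrs_matching:
  assumes xy: "x \<rightarrow> y"
  defines "A \<equiv> nbrs x - insert y (nbrs y)" and "B \<equiv> nbrs y - insert x (nbrs x)"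
  shows "\<exists>T f. T \<subseteq> A \<and> inj_on f T \<and> (\<forall>a\<in>T. f a \<in> B \<and> a \<rightarrow> f a)
    \<and> card A + 2 * vertex_connectivity G \<le> card T + card (nbrs x \<inter> nbrs y) + card (verts G)"
proof -
  let ?k = "vertex_connectivity G"
  let ?c = "card (nbrs x \<inter> nbrs y)"
  let ?E = "arcs_ends G \<inter> A \<times> B"
  have finA: "finite A" and finB: "finite B" using finite_nbrs by (auto simp: A_def B_def)
  have yx: "y \<rightarrow> x" using xy by (rule graph_symmetric)
  have V: "x \<in> verts G" "y \<in> verts G" using xy adj_in_verts by blast+
  have AV: "A \<subseteq> verts G" "B \<subseteq> verts G" using nbrs_subset by (auto simp: A_def B_def)
  have "nbrs y = insert x ((nbrs x \<inter> nbrs y) \<union> B)"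
    using yx by (auto simp: B_def)
  moreover have "x \<notin> nbrs x" using nbrs_subset by blast
  ultimately have "out_degree G y = Suc (card ((nbrs x \<inter> nbrs y) \<union> B))"
    unfolding out_degree_eq_card_nbrs using finite_nbrs finB
    by (metis (no_types, lifting) B_def DiffD2 IntD1 UnE card_insert_disjoint finite_Int finite_Un insertI1)
  also have "card ((nbrs x \<inter> nbrs y) \<union> B) = ?c + card B"
    using finite_nbrs finB by (intro card_Un_disjoint) (auto simp: B_def)
  finally have degy: "?k \<le> Suc (?c + card B)"
    using vertex_connectivity_le_out_degree[OF V(2)] by simp
  \<comment> \<open>Truncated subtraction is harmless: \<open>a - b \<le> t\<close> is equivalent to
    \<open>a \<le> t + b\<close> for naturals too.\<close>
  have "\<exists>T f. T \<subseteq> A \<and> inj_on f T \<and> (\<forall>a\<in>T. (a, f a) \<in> ?E)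
      \<and> card A + 2 * ?k - (?c + card (verts G)) \<le> card T"
  proof (rule bipartite_matching[OF _ finA])
    show "finite ?E" using finA finB by blast
    fix X assume X: "X \<subseteq> A"
    then have finX: "finite X" using finA finite_subset by blast
    have cX: "card (A - X) + card X = card A"
      using X finA finX card_mono[OF finA X] by (simp add: card_Diff_subset)
    show "card A + 2 * ?k - (?c + card (verts G)) \<le> card (?E `` X) + card (A - X)"
    proof (cases "X = {}")
      case True
      \<comment> \<open>An empty \<open>X\<close> separates nothing, but then the degree sum alone
        suffices.\<close>
      have "card (nbrs x \<union> nbrs y) \<le> card (verts G)"
        using nbrs_subset by (intro card_mono) auto
      then show ?thesis using card_nbrs_Int[OF V] cX True by simp
    next
      case False
      \<comment> \<open>No vertex of \<open>A\<close> is adjacent to \<open>y\<close>, so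
        \<open>y\<close> may join. It keeps \<open>?Y\<close> nonempty, and its 1 offsets the 1 that
        \<open>x\<close> contributes to the degree of \<open>y\<close> in
        \<open>degy\<close>.\<close>
      let ?Y = "insert y (B - ?E `` X)"
      have "y \<notin> B" using nbrs_subset by (auto simp: B_def)
      have "?E `` X \<subseteq> B" by auto
      then have "card (B - ?E `` X) + card (?E `` X) = card B"
        using finB card_mono[OF finB] by (simp add: card_Diff_subset finite_subset)
      moreover have "card ?Y = Suc (card (B - ?E `` X))"
        using \<open>y \<notin> B\<close> finB by (subst card_insert_disjoint) auto
      moreover have "?k + card X + card ?Y \<le> card (verts G)"
      proof (rule separation_bound)
        show "X \<inter> ?Y = {}" using X by (auto simp: A_def B_def)
        show "\<not> a \<rightarrow> b" if "a \<in> X" "b \<in> ?Y" for a b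
          using that X graph_symmetric by (auto simp: A_def)
      qed (use False X AV V in auto)
      ultimately show ?thesis using degy cX by linarith
    qed
  qed
  then obtain T f where "T \<subseteq> A" "inj_on f T" "\<forall>a\<in>T. (a, f a) \<in> ?E"
    "card A + 2 * ?k - (?c + card (verts G)) \<le> card T" by blast
  then show ?thesis by (intro exI[of _ T] exI[of _ f]) auto
qed

lemma wasserstein_dense_bound:
  assumes k: "card (verts G) \<le> 2 * vertex_connectivity G + 1"
    and xy: "x \<rightarrow> y" and deg: "out_degree G y \<le> out_degree G x"
  defines "p \<equiv> 1 / (real (out_degree G x) + 1)"
  shows "wasserstein G (lazy_walk G p x) (lazy_walk G p y)
    \<le> 1 - p * (2 * real (vertex_connectivity G) - real (card (verts G)) + 2)"
proof -
  define A where "A = nbrs x - insert y (nbrs y)"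
  define B where "B = nbrs y - insert x (nbrs x)"
  define C where "C = nbrs x \<inter> nbrs y"
  obtain T f where T: "T \<subseteq> A" "inj_on f T" "\<And>a. a \<in> T \<Longrightarrow> f a \<in> B" "\<And>a. a \<in> T \<Longrightarrow> a \<rightarrow> f a"
    and cT: "card A + 2 * vertex_connectivity G \<le> card T + card C + card (verts G)"
    using private_nbrs_matching[OF xy] unfolding A_def B_def C_def by blast
  define I where "I = {x, y} \<union> C"
  \<comment> \<open>One injection between the closed neighbourhoods: the identity on
    \<open>I\<close>, at cost 0, and the matching on \<open>T\<close>, at distance 1.\<close>
  define g where "g u = (if u \<in> T then f u else u)" for u
  have yx: "y \<rightarrow> x" using xy by (rule graph_symmetric)
  have V: "x \<in> verts G" "y \<in> verts G" using xy adj_in_verts by blast+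
  have ne: "x \<noteq> y" "x \<notin> nbrs x" "y \<notin> nbrs y" using xy nbrs_subset by blast+
  have fin: "finite A" "finite B" "finite C" "finite I" "finite T"
    using finite_nbrs T(1) finite_subset[of T A] by (auto simp: A_def B_def C_def I_def)
  have cI: "card I = card C + 2"
    using ne fin by (simp add: I_def C_def)
  have disj: "I \<inter> T = {}" using T(1) ne by (auto simp: I_def A_def C_def)
  have gI: "g u = u" if "u \<in> I" for u using disj that by (auto simp: g_def)
  have gT: "g u = f u" if "u \<in> T" for u using that by (simp add: g_def)
  have "nbrs x = insert y (C \<union> A)" using xy by (auto simp: A_def C_def)
  moreover have "y \<notin> C \<union> A" using ne by (auto simp: A_def C_def)
  moreover have "card (C \<union> A) = card C + card A"
    using fin by (intro card_Un_disjoint) (auto simp: A_def C_def)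
  ultimately have degx: "out_degree G x = Suc (card C + card A)"
    using fin by (simp add: out_degree_eq_card_nbrs)
  have degy: "0 < out_degree G y"
    using yx finite_nbrs by (auto simp: out_degree_eq_card_nbrs card_gt_0_iff)
  have p: "0 < p" "p < 1" "(1 - p) / real (out_degree G x) = p"
    using degx by (simp_all add: p_def divide_simps)
  have px: "p \<le> lazy_walk G p x u" if "u \<in> insert x (nbrs x)" for u
    using that p by (auto simp: lazy_walk_def)
  \<comment> \<open>Here \<open>deg\<close> enters: a smaller degree at \<open>y\<close> gives each
    of its neighbours at least mass \<open>p\<close>.\<close>
  have "(1 - p) / real (out_degree G x) \<le> (1 - p) / real (out_degree G y)"
    using deg degy p by (intro divide_left_mono) auto
  then have py: "p \<le> lazy_walk G p y u" if "u \<in> insert y (nbrs y)" for u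
    using that p by (auto simp: lazy_walk_def)
  have "inj_on g (I \<union> T)"
  proof -
    have "inj_on g I" using gI by (simp add: inj_on_def)
    moreover have "inj_on g T" using T(2) gT by (simp add: inj_on_def)
    \<comment> \<open>The matching ends in \<open>B\<close>, which avoids \<open>x\<close>,
      \<open>y\<close> and the common neighbours.\<close>
    moreover have "g ` I \<inter> g ` T = {}"
      using gI gT T(3) ne xy by (fastforce simp: I_def B_def C_def)
    ultimately show ?thesis by (auto simp: inj_on_Un)
  qed
  moreover have "I \<union> T \<subseteq> insert x (nbrs x)"
    using T(1) xy by (auto simp: I_def A_def C_def)
  moreover have "g ` (I \<union> T) \<subseteq> insert y (nbrs y)"
    using gI gT T(3) yx by (auto simp: I_def B_def C_def)
  moreover have "insert x (nbrs x) \<subseteq> verts G" "insert y (nbrs y) \<subseteq> verts G"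
    using V nbrs_subset by blast+
  ultimately have "wasserstein G (lazy_walk G p x) (lazy_walk G p y)
      \<le> p * (\<Sum>u\<in>I \<union> T. graph_dist G u (g u)) + 2 * (1 - p * real (card (I \<union> T)))"
    using p px py xy yx sum_lazy_walk lazy_walk_nonneg dense_graph_dist_le_2[OF k]
    by (intro wasserstein_partial_matching) (auto simp: subset_iff image_subset_iff)
  also have "(\<Sum>u\<in>I \<union> T. graph_dist G u (g u))
      = (\<Sum>u\<in>I. graph_dist G u (g u)) + (\<Sum>u\<in>T. graph_dist G u (g u))"
    using fin disj by (intro sum.union_disjoint)
  also have "(\<Sum>u\<in>T. graph_dist G u (g u)) = real (card T)"
    using T(4) gT by (simp add: graph_dist_adjacent)
  also have "(\<Sum>u\<in>I. graph_dist G u (g u)) = 0"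
  proof (rule sum.neutral, rule ballI)
    fix u assume u: "u \<in> I"
    then have "u \<in> verts G" using V nbrs_subset by (auto simp: I_def C_def)
    with u show "graph_dist G u (g u) = 0"
      using gI graph_dist_self graph_dist_nonneg[of u u] by fastforce
  qed
  also have "card (I \<union> T) = card C + 2 + card T"
    using fin disj cI by (simp add: card_Un_disjoint)
  finally have W: "wasserstein G (lazy_walk G p x) (lazy_walk G p y)
      \<le> p * real (card T) + 2 * (1 - p * real (card C + 2 + card T))" by simp
  \<comment> \<open>Substituting \<open>degx\<close> into \<open>cT\<close> eliminates
    \<open>card A\<close>; the subtracted \<open>p * (d_x + 1)\<close> equals 1 and turns the 2 in
    \<open>W\<close> into the claimed 1.\<close>
  have "p * (2 * real (vertex_connectivity G) - real (card (verts G)) + 2)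
      \<le> p * (2 * real (card C) + 4 + real (card T) - (real (out_degree G x) + 1))"
    using cT p(1) degx by (intro mult_left_mono) auto
  also have "\<dots> = p * (2 * real (card C) + 4 + real (card T)) - 1"
  proof -
    have "p * (real (out_degree G x) + 1) = 1" by (simp add: p_def)
    then show ?thesis by (simp only: right_diff_distrib)
  qed
  finally show ?thesis using W by (simp add: algebra_simps)
qed

end

theorem theorem1p7:
  fixes G :: "('a, 'b) pre_digraph" and n :: nat and x y :: 'a
  assumes "graph G"
    and "n = card (verts G)"
    and "real (vertex_connectivity G) \<ge> (real n - 1) / 2"
    and "x \<rightarrow>\<^bsub>G\<^esub> y"
    and "out_degree G x \<ge> out_degree G y"
  shows "lly_curvature G x y
    \<ge> (2 * real (vertex_connectivity G) - real n + 2) / real (out_degree G x)"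
proof -
  interpret graph G by fact
  let ?p = "1 / (real (out_degree G x) + 1)"
  let ?K = "2 * real (vertex_connectivity G) - real n + 2"
  have k: "card (verts G) \<le> 2 * vertex_connectivity G + 1"
  proof -
    have "real n \<le> real (2 * vertex_connectivity G + 1)" using assms(3) by simp
    then show ?thesis using assms(2) by (simp only: of_nat_le_iff)
  qed
  have pos: "0 < out_degree G x"
    using assms(4) finite_nbrs by (auto simp: out_degree_eq_card_nbrs card_gt_0_iff)
  have "?p * ?K \<le> ollivier_curvature G ?p x y"
    using wasserstein_dense_bound[OF k assms(4,5)] assms(2,4)
    by (simp add: ollivier_curvature_def graph_dist_adjacent)
  then have "?p * ?K / (1 - ?p) \<le> ollivier_curvature G ?p x y / (1 - ?p)"
    using pos by (intro divide_right_mono) auto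
  also have "\<dots> \<le> lly_curvature G x y"
    using assms(4) pos dense_reachable[OF k] by (intro ollivier_le_lly_curvature) auto
  \<comment> \<open>For this idleness \<open>?p / (1 - ?p)\<close> is exactly 1 over the degree of
    \<open>x\<close>.\<close>
  also have "?p * ?K / (1 - ?p) = ?K / real (out_degree G x)"
    using pos by (simp add: divide_simps)
  finally show ?thesis .
qed

end
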